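(* Let $R$ be a ring. The following conditions are equivalent: (1) $R$ is conjugate clean; (2) $R/J(R)$ is conjugate clean and idempotents lift modulo $J(R)$; (3) there exist a conjugate clean subring $A$ of $R$ and a Jacobson radical ideal $I$ of $R$ such that: (i) $R=A+I$; (ii) $U(A)=U(R)\cap A$; (iii) every idempotent of $R$ is of the form $e+x$ for some $e=e^2\in A$ and $x\in I$.
   Context: Rings are associative with unity and subrings contain the unity of the overring. $J(R)$ is the Jacobson radical and $U(R)$ the group of units of $R$. A Jacobson radical ideal of $R$ is a two-sided ideal $I$ with $J(I)=I$, equivalently $I\subseteq J(R)$. Idempotents lift modulo an ideal $I$ of $R$ if for every $a\in R$ with $a^2-a\in I$ there is an idempotent $e\in R$ with $e-a\in I$. A clean decomposition of $a\in R$ is an equation $a=e+u$ with $e=e^2\in R$ and $u\in U(R)$. $R$ is conjugate clean if every element of $R$ has a clean decomposition and, whenever $a=e+u=f+v$ are two clean decompositions of the same element $a\in R$, the idempotents $e,f$ are conjugate in $R$, i.e. $e=wfw^{-1}$ for some $w\in U(R)$. *)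

theory Defs
  imports "HOL-Algebra.Subrings"
begin

text \<open>
  Rings are the unital, not necessarily commutative rings of \<^locale>\<open>ring\<close>. A subset \<open>S\<close> of
  \<open>R\<close> is turned into a structure of its own by \<open>R\<lparr>carrier := S\<rparr>\<close>; this is used for subrings
  and also for ideals, regarded as rings without unity.
\<close>

definition left_ideal :: "'a set \<Rightarrow> ('a, 'b) ring_scheme \<Rightarrow> bool" where
  "left_ideal M R \<longleftrightarrow>
     additive_subgroup M R \<and> (\<forall>r\<in>carrier R. \<forall>m\<in>M. r \<otimes>\<^bsub>R\<^esub> m \<in> M)"

definition maximal_left_ideal :: "'a set \<Rightarrow> ('a, 'b) ring_scheme \<Rightarrow> bool" where
  "maximal_left_ideal M R \<longleftrightarrow>
     left_ideal M R \<and> M \<noteq> carrier R \<and>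
     (\<forall>N. left_ideal N R \<and> M \<subseteq> N \<longrightarrow> N = M \<or> N = carrier R)"

definition modular_left_ideal :: "'a set \<Rightarrow> ('a, 'b) ring_scheme \<Rightarrow> bool" where
  "modular_left_ideal M R \<longleftrightarrow>
     left_ideal M R \<and> (\<exists>e\<in>carrier R. \<forall>x\<in>carrier R. x \<ominus>\<^bsub>R\<^esub> x \<otimes>\<^bsub>R\<^esub> e \<in> M)"

text \<open>
  The Jacobson radical in the generality of rings that may lack a unity, which is needed to
  speak of \<open>J(I)\<close> for an ideal \<open>I\<close>. The definition never refers to \<open>\<one>\<close>. If a unity is present,
  every left ideal is modular (take \<open>e = \<one>\<close>), and \<open>J(R)\<close> is the intersection of all maximal left
  ideals; see \<open>jacobson_radical_unital\<close> below. The intersection with the carrier covers the case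
  where there are no maximal modular left ideals, in which the radical is everything.
\<close>

definition jacobson_radical :: "('a, 'b) ring_scheme \<Rightarrow> 'a set" where
  "jacobson_radical R =
     carrier R \<inter> \<Inter>{M. maximal_left_ideal M R \<and> modular_left_ideal M R}"

lemma (in ring) left_ideal_modular:
  assumes "left_ideal M R"
  shows "modular_left_ideal M R"
proof -
  interpret additive_subgroup M R
    using assms by (simp add: left_ideal_def)
  have "x \<ominus> x \<otimes> \<one> \<in> M" if "x \<in> carrier R" for x
    using that by (simp add: a_minus_def r_neg)
  then show ?thesis
    using assms unfolding modular_left_ideal_def by blast
qed

lemma (in ring) jacobson_radical_unital:
  "jacobson_radical R = carrier R \<inter> \<Inter>{M. maximal_left_ideal M R}"
  using left_ideal_modular by (auto simp: jacobson_radical_def maximal_left_ideal_def)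

definition jacobson_radical_ideal :: "'a set \<Rightarrow> ('a, 'b) ring_scheme \<Rightarrow> bool" where
  "jacobson_radical_ideal I R \<longleftrightarrow> ideal I R \<and> jacobson_radical (R\<lparr>carrier := I\<rparr>) = I"

definition idempotents :: "('a, 'b) ring_scheme \<Rightarrow> 'a set" where
  "idempotents R = {e \<in> carrier R. e \<otimes>\<^bsub>R\<^esub> e = e}"

definition idempotents_lift :: "('a, 'b) ring_scheme \<Rightarrow> 'a set \<Rightarrow> bool" where
  "idempotents_lift R I \<longleftrightarrow>
     (\<forall>a\<in>carrier R. a \<otimes>\<^bsub>R\<^esub> a \<ominus>\<^bsub>R\<^esub> a \<in> I \<longrightarrow> (\<exists>e\<in>idempotents R. e \<ominus>\<^bsub>R\<^esub> a \<in> I))"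

definition clean_decomposition :: "('a, 'b) ring_scheme \<Rightarrow> 'a \<Rightarrow> 'a \<Rightarrow> 'a \<Rightarrow> bool" where
  "clean_decomposition R a e u \<longleftrightarrow>
     e \<in> idempotents R \<and> u \<in> Units R \<and> a = e \<oplus>\<^bsub>R\<^esub> u"

definition conjugate_in :: "('a, 'b) ring_scheme \<Rightarrow> 'a \<Rightarrow> 'a \<Rightarrow> bool" where
  "conjugate_in R e f \<longleftrightarrow> (\<exists>w\<in>Units R. e = w \<otimes>\<^bsub>R\<^esub> f \<otimes>\<^bsub>R\<^esub> inv\<^bsub>R\<^esub> w)"

definition conjugate_clean :: "('a, 'b) ring_scheme \<Rightarrow> bool" where
  "conjugate_clean R \<longleftrightarrow>
     (\<forall>a\<in>carrier R. \<exists>e u. clean_decomposition R a e u) \<and>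
     (\<forall>a\<in>carrier R. \<forall>e u f v.
        clean_decomposition R a e u \<and> clean_decomposition R a f v \<longrightarrow> conjugate_in R e f)"

end

theory Submission
  imports Defs "HOL-Algebra.QuotRing"
begin

text \<open>
  Both equivalences rest on one property of an ideal \<open>I\<close>, quasi-regularity: \<open>1 + x\<close> is a unit for
  every \<open>x \<in> I\<close>. The radical \<open>J(R)\<close> has it, and so has every ideal with \<open>J(I) = I\<close>. Indeed,
  if \<open>x \<in> J(K)\<close> were not in the left ideal \<open>{y - yx | y \<in> K}\<close> of \<open>K\<close>, Zorn's lemma would enlarge
  this left ideal to a maximal one missing \<open>x\<close>, which is modular because \<open>x\<close> is a right unit modulo
  it; but \<open>x\<close> lies in all such left ideals. So \<open>x = y - yx\<close>, that is \<open>(1 + y)(1 - x) = 1\<close>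
  (\<open>jacobson_radical_left_quasi_inverse\<close>), and one-sided inverses inside an ideal become two-sided
  (\<open>quasi_regular_if_left_quasi_inverses\<close>).

  Modulo a quasi-regular ideal nothing about units is lost: an element congruent to a unit is a
  unit. Nor is anything lost about conjugacy: if \<open>e\<close> and \<open>f\<close> are idempotents with \<open>e - f \<in> I\<close>, then
  \<open>p = ef + (1 - e)(1 - f)\<close> lies in \<open>1 + I\<close> and satisfies \<open>ep = ef = pf\<close>
  (\<open>conjugate_if_congruent\<close>). Hence, as soon as idempotents lift, clean decompositions of the class
  of \<open>a\<close> are exactly the classes of clean decompositions of \<open>a\<close>, with conjugacy of the idempotents
  preserved in both directions. Lifting itself follows from cleanness alone: if \<open>a = e + u\<close>, the
  idempotent \<open>f = u\<^sup>-\<^sup>1(1 - e)u\<close> satisfies \<open>u(f - a) = -(a\<^sup>2 - a)\<close> (\<open>idempotents_lift_if_clean\<close>). This is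
  the equivalence of (1) and (2).

  For (1) implies (3) take \<open>A = R\<close> and \<open>I = 0\<close>. Conversely, adding an element of \<open>I\<close> to the unit
  turns a decomposition in \<open>A\<close> into one of any congruent element of \<open>R\<close>. Given \<open>e + u = f + v\<close> in
  \<open>R\<close>, replace \<open>e\<close>, \<open>f\<close>, \<open>u\<close> by congruent elements \<open>e\<^sub>0\<close>, \<open>f\<^sub>0\<close>, \<open>a\<close> of \<open>A\<close>, the first two idempotent,
  and put \<open>b = a + e\<^sub>0 - f\<^sub>0\<close>. Then \<open>b\<close> is congruent to \<open>v\<close>, so \<open>a\<close> and \<open>b\<close> are units, and
  \<open>e\<^sub>0 + a = f\<^sub>0 + b\<close> in \<open>A\<close>. Hence \<open>e\<^sub>0\<close> and \<open>f\<^sub>0\<close> are conjugate in \<open>A\<close>, so \<open>e\<close> and \<open>f\<close> are conjugate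
  modulo \<open>I\<close>, and therefore in \<open>R\<close> (\<open>conjugate_clean_if_complement\<close>).
\<close>

section \<open>Quasi-regularity of the Jacobson radical\<close>

text \<open>
  An ideal \<open>K\<close> is treated as a ring without unity, so facts about unital rings do not apply to it.
  This criterion moves the work on its left ideals into the ambient ring.
\<close>

lemma (in ring) left_ideal_of_ideal_iff:
  assumes "ideal K R"
  shows "left_ideal M (R\<lparr>carrier := K\<rparr>) \<longleftrightarrow>
    M \<subseteq> K \<and> \<zero> \<in> M \<and> (\<forall>a\<in>M. \<forall>b\<in>M. a \<oplus> b \<in> M) \<and> (\<forall>a\<in>M. \<ominus> a \<in> M) \<and>
    (\<forall>r\<in>K. \<forall>m\<in>M. r \<otimes> m \<in> M)"
proof -
  interpret K: ideal K R by fact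
  have inv: "inv\<^bsub>(add_monoid R)\<lparr>carrier := K\<rparr>\<^esub> a = \<ominus> a" if "a \<in> K" for a
    using add.m_inv_consistent[OF K.a_subgroup that] by (simp add: a_inv_def)
  have "additive_subgroup M (R\<lparr>carrier := K\<rparr>) \<longleftrightarrow> subgroup M ((add_monoid R)\<lparr>carrier := K\<rparr>)"
    by (simp add: additive_subgroup_def)
  also have "\<dots> \<longleftrightarrow> M \<subseteq> K \<and> \<zero> \<in> M \<and> (\<forall>a\<in>M. \<forall>b\<in>M. a \<oplus> b \<in> M) \<and> (\<forall>a\<in>M. \<ominus> a \<in> M)"
    using inv by (auto simp: subgroup_def subset_iff)
  finally show ?thesis
    by (auto simp: left_ideal_def)
qed

lemma (in ring) left_ideal_of_idealD:
  assumes "ideal K R" "left_ideal M (R\<lparr>carrier := K\<rparr>)"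
  shows "M \<subseteq> K" "\<zero> \<in> M" "\<And>a b. a \<in> M \<Longrightarrow> b \<in> M \<Longrightarrow> a \<oplus> b \<in> M" "\<And>a. a \<in> M \<Longrightarrow> \<ominus> a \<in> M"
    "\<And>r m. r \<in> K \<Longrightarrow> m \<in> M \<Longrightarrow> r \<otimes> m \<in> M"
  using assms(2) by (simp_all add: left_ideal_of_ideal_iff[OF assms(1)])

lemma (in ring) minus_of_ideal:
  assumes "ideal K R" "x \<in> K" "y \<in> K"
  shows "x \<ominus>\<^bsub>R\<lparr>carrier := K\<rparr>\<^esub> y = x \<ominus> y"
proof -
  interpret K: ideal K R by fact
  show ?thesis
    using add.m_inv_consistent[OF K.a_subgroup assms(3)] by (simp add: a_minus_def a_inv_def)
qed

text \<open>
  The choice \<open>K = R\<close> gives information on \<open>J(R)\<close>, and \<open>K = I\<close> on ideals with \<open>J(I) = I\<close>. A left ideal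
  containing \<open>L = {y - yx | y \<in> K}\<close> is proper exactly if it misses \<open>x\<close>, since
  \<open>y = (y - yx) + yx\<close>. So a left ideal that contains \<open>L\<close> and is maximal among those missing \<open>x\<close> is a
  maximal left ideal, and \<open>x\<close> itself witnesses that it is modular.
\<close>

lemma (in ring) jacobson_radical_left_quasi_inverse:
  assumes K: "ideal K R" and x: "x \<in> jacobson_radical (R\<lparr>carrier := K\<rparr>)"
  shows "\<exists>y\<in>K. x = y \<ominus> y \<otimes> x"
proof (rule ccontr)
  interpret K: ideal K R by fact
  let ?S = "R\<lparr>carrier := K\<rparr>"
  assume no_y: "\<not> ?thesis"
  have xK: "x \<in> K"
    using x by (simp add: jacobson_radical_def)
  have Kc: "y \<in> carrier R" if "y \<in> K" for y
    using that K.a_subset by blast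
  note xc = Kc[OF xK]
  define L where "L = {y \<ominus> y \<otimes> x | y. y \<in> K}"
  define F where "F = {N. left_ideal N ?S \<and> L \<subseteq> N \<and> x \<notin> N}"
  have "left_ideal L ?S"
    unfolding left_ideal_of_ideal_iff[OF K]
  proof (intro conjI ballI)
    show "L \<subseteq> K"
      using xc by (auto simp: L_def a_minus_def K.I_r_closed Kc)
    show "\<zero> \<in> L"
      using xc by (auto simp: L_def a_minus_def intro!: exI[of _ \<zero>])
    show "a \<oplus> b \<in> L" if "a \<in> L" "b \<in> L" for a b
    proof -
      obtain y z where yz: "y \<in> K" "z \<in> K" and ab: "a = y \<ominus> y \<otimes> x" "b = z \<ominus> z \<otimes> x"
        using \<open>a \<in> L\<close> \<open>b \<in> L\<close> unfolding L_def mem_Collect_eq by metis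
      then have "a \<oplus> b = (y \<oplus> z) \<ominus> (y \<oplus> z) \<otimes> x"
        using Kc xc by (simp add: a_minus_def l_distr minus_add a_ac)
      then show ?thesis using yz by (auto simp: L_def)
    qed
    show "\<ominus> a \<in> L" if "a \<in> L" for a
    proof -
      obtain y where y: "y \<in> K" "a = y \<ominus> y \<otimes> x"
        using \<open>a \<in> L\<close> unfolding L_def mem_Collect_eq by metis
      then have "\<ominus> a = (\<ominus> y) \<ominus> (\<ominus> y) \<otimes> x"
        using Kc xc by (simp add: a_minus_def l_minus minus_add a_ac)
      then show ?thesis using y by (auto simp: L_def)
    qed
    show "r \<otimes> a \<in> L" if "r \<in> K" "a \<in> L" for r a
    proof -
      obtain y where y: "y \<in> K" "a = y \<ominus> y \<otimes> x"
        using \<open>a \<in> L\<close> unfolding L_def mem_Collect_eq by metis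
      then have "r \<otimes> a = (r \<otimes> y) \<ominus> (r \<otimes> y) \<otimes> x"
        using Kc xc that by (simp add: a_minus_def r_distr r_minus m_assoc)
      then show ?thesis using y that Kc K.I_l_closed by (auto simp: L_def)
    qed
  qed
  moreover have "x \<notin> L"
    using no_y by (auto simp: L_def)
  ultimately have "L \<in> F"
    by (simp add: F_def)
  have "\<exists>M\<in>F. \<forall>X\<in>F. M \<subseteq> X \<longrightarrow> X = M"
  proof (rule subset_Zorn_nonempty)
    show "F \<noteq> {}" using \<open>L \<in> F\<close> by blast
    fix C assume C: "C \<noteq> {}" "subset.chain F C"
    have CF: "N \<in> F" if "N \<in> C" for N
      using C(2) that by (auto simp: subset.chain_def)
    have "left_ideal N ?S" if "N \<in> C" for N
      using CF[OF that] by (simp add: F_def)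
    note li = left_ideal_of_idealD[OF K this]
    have "left_ideal (\<Union>C) ?S"
      unfolding left_ideal_of_ideal_iff[OF K]
    proof (intro conjI ballI)
      show "\<Union>C \<subseteq> K"
        using li(1) by blast
      show "\<zero> \<in> \<Union>C"
        using li(2) C(1) by blast
      show "a \<oplus> b \<in> \<Union>C" if ab: "a \<in> \<Union>C" "b \<in> \<Union>C" for a b
      proof -
        obtain N N' where N: "N \<in> C" "a \<in> N" "N' \<in> C" "b \<in> N'"
          using ab by blast
        then have "N \<subseteq> N' \<or> N' \<subseteq> N"
          using C(2) unfolding subset_chain_def by blast
        then show ?thesis
          using N li(3)[OF N(1)] li(3)[OF N(3)] by blast
      qed
      show "\<ominus> a \<in> \<Union>C" if "a \<in> \<Union>C" for a
        using that li(4) by blast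
      show "r \<otimes> a \<in> \<Union>C" if "r \<in> K" "a \<in> \<Union>C" for r a
        using that li(5) by blast
    qed
    then show "\<Union>C \<in> F"
      using C(1) CF by (auto simp: F_def)
  qed
  then obtain M where M: "M \<in> F" and max: "\<And>X. X \<in> F \<Longrightarrow> M \<subseteq> X \<Longrightarrow> X = M"
    by blast
  have LM: "L \<subseteq> M" and xM: "x \<notin> M" and liM: "left_ideal M ?S"
    using M by (auto simp: F_def)
  have "N = M \<or> N = K" if N: "left_ideal N ?S" "M \<subseteq> N" for N
  proof (cases "x \<in> N")
    case False
    then show ?thesis using N LM max by (auto simp: F_def)
  next
    case True
    have "y \<in> N" if y: "y \<in> K" for y
    proof -
      have "y \<ominus> y \<otimes> x \<in> N" using y LM N(2) by (auto simp: L_def)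
      moreover have "y \<otimes> x \<in> N"
        using left_ideal_of_idealD(5)[OF K N(1)] True y by blast
      ultimately have "(y \<ominus> y \<otimes> x) \<oplus> y \<otimes> x \<in> N"
        using left_ideal_of_idealD(3)[OF K N(1)] by blast
      then show ?thesis using Kc[OF y] xc
        by (simp add: a_minus_def a_assoc l_neg)
    qed
    then show ?thesis
      using left_ideal_of_idealD(1)[OF K N(1)] by blast
  qed
  then have "maximal_left_ideal M ?S"
    using liM xM xK by (auto simp: maximal_left_ideal_def)
  moreover have "modular_left_ideal M ?S"
    unfolding modular_left_ideal_def using liM LM xK
    by (auto simp: L_def K.I_l_closed Kc minus_of_ideal[OF K] intro!: bexI[of _ x])
  ultimately show False
    using x xM by (auto simp: jacobson_radical_def)
qed

locale quasi_regular_ideal = ideal +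
  assumes one_plus_unit: "x \<in> I \<Longrightarrow> \<one> \<oplus> x \<in> Units R"

text \<open>
  The left inverse of \<open>1 + x\<close> is again of the form \<open>1 + y\<close> with \<open>y \<in> I\<close>, so it has a left inverse as
  well. An element with a left inverse that is itself left invertible is a unit.
\<close>

lemma (in ideal) quasi_regular_if_left_quasi_inverses:
  assumes left: "\<And>x. x \<in> I \<Longrightarrow> \<exists>y\<in>I. x = y \<ominus> y \<otimes> x"
  shows "quasi_regular_ideal I R"
proof unfold_locales
  have Ic: "y \<in> carrier R" if "y \<in> I" for y
    using that a_subset by blast
  have left_inv: "\<exists>y\<in>I. (\<one> \<oplus> y) \<otimes> (\<one> \<oplus> x) = \<one>" if x: "x \<in> I" for x
  proof -
    \<comment> \<open>A quasi-inverse of \<open>-x\<close> gives \<open>(1 + y)(1 - (-x)) = 1\<close>.\<close>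
    obtain y where y: "y \<in> I" "\<ominus> x = y \<ominus> y \<otimes> (\<ominus> x)"
      using left[of "\<ominus> x"] x by auto
    note c = Ic[OF x] Ic[OF y(1)]
    have "(\<one> \<oplus> y) \<otimes> (\<one> \<oplus> x) = \<one> \<oplus> (x \<oplus> (y \<ominus> y \<otimes> (\<ominus> x)))"
      using c by (simp add: a_minus_def l_distr r_distr r_minus minus_add a_ac)
    also have "\<dots> = \<one>"
      using c by (simp add: y(2)[symmetric] r_neg)
    finally show ?thesis using y(1) by blast
  qed
  fix x assume x: "x \<in> I"
  obtain y where y: "y \<in> I" "(\<one> \<oplus> y) \<otimes> (\<one> \<oplus> x) = \<one>"
    using left_inv[OF x] by blast
  obtain z where z: "z \<in> I" "(\<one> \<oplus> z) \<otimes> (\<one> \<oplus> y) = \<one>"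
    using left_inv[OF y(1)] by blast
  have "\<one> \<oplus> z = \<one> \<oplus> x"
    using inv_unique[OF z(2) y(2)] Ic x y(1) z(1) by simp
  then show "\<one> \<oplus> x \<in> Units R"
    using y z x Ic unfolding Units_def by auto
qed

lemma (in ring) jacobson_radical_ideal_quasi_regular:
  assumes "jacobson_radical_ideal I R"
  shows "quasi_regular_ideal I R"
  using assms jacobson_radical_left_quasi_inverse[of I]
  by (auto simp: jacobson_radical_ideal_def intro!: ideal.quasi_regular_if_left_quasi_inverses)

lemma (in ring) left_ideal_iff:
  "left_ideal M R \<longleftrightarrow>
    M \<subseteq> carrier R \<and> \<zero> \<in> M \<and> (\<forall>a\<in>M. \<forall>b\<in>M. a \<oplus> b \<in> M) \<and> (\<forall>a\<in>M. \<ominus> a \<in> M) \<and>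
    (\<forall>r\<in>carrier R. \<forall>m\<in>M. r \<otimes> m \<in> M)"
  using left_ideal_of_ideal_iff[OF oneideal, of M] by simp

lemma (in ring) left_ideal_jacobson_radical:
  "left_ideal (jacobson_radical R) R"
  unfolding left_ideal_iff jacobson_radical_unital maximal_left_ideal_def by auto

lemma (in ring) jacobson_radical_one_minus:
  assumes "x \<in> jacobson_radical R"
  shows "\<exists>c\<in>carrier R. c \<otimes> (\<one> \<ominus> x) = \<one>"
proof -
  have x: "x \<in> carrier R" using assms by (simp add: jacobson_radical_def)
  obtain y where y: "y \<in> carrier R" "x = y \<ominus> y \<otimes> x"
    using jacobson_radical_left_quasi_inverse[OF oneideal] assms by auto
  have "(\<one> \<oplus> y) \<otimes> (\<one> \<ominus> x) = \<one> \<oplus> (\<ominus> x \<oplus> (y \<ominus> y \<otimes> x))"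
    using x y(1) by (simp add: a_minus_def l_distr r_distr r_minus minus_add a_ac)
  also have "\<dots> = \<one>"
    using x by (simp add: y(2)[symmetric] l_neg)
  finally show ?thesis using y(1) by blast
qed

lemma (in ring) left_inverse_one_minus_swap:
  assumes abc: "a \<in> carrier R" "b \<in> carrier R" "c \<in> carrier R"
    and c: "c \<otimes> (\<one> \<ominus> a \<otimes> b) = \<one>"
  shows "(\<one> \<oplus> b \<otimes> c \<otimes> a) \<otimes> (\<one> \<ominus> b \<otimes> a) = \<one>"
proof -
  have "(\<one> \<oplus> b \<otimes> c \<otimes> a) \<otimes> (\<one> \<ominus> b \<otimes> a) =
      \<one> \<oplus> (\<ominus> (b \<otimes> a) \<oplus> b \<otimes> (c \<otimes> (\<one> \<ominus> a \<otimes> b)) \<otimes> a)"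
    using abc by (simp add: a_minus_def l_distr r_distr r_minus l_minus minus_add a_ac m_assoc)
  then show ?thesis
    using abc by (simp add: c l_neg)
qed

text \<open>
  The definition by maximal left ideals makes \<open>J(R)\<close> a left ideal at once; closure under right
  multiplication needs an argument. If \<open>xr \<notin> M\<close> for a maximal left ideal \<open>M\<close>, then \<open>M + Rxr = R\<close>, so
  \<open>1 - sxr \<in> M\<close> for some \<open>s\<close>. But \<open>rsx \<in> J(R)\<close>, so \<open>1 - rsx\<close> is left invertible, hence so is
  \<open>1 - sxr\<close>, which cannot lie in \<open>M\<close>.
\<close>

lemma (in ring) ideal_jacobson_radical: "ideal (jacobson_radical R) R"
proof -
  let ?J = "jacobson_radical R"
  have J: "?J \<subseteq> carrier R" "\<And>r x. r \<in> carrier R \<Longrightarrow> x \<in> ?J \<Longrightarrow> r \<otimes> x \<in> ?J"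
    using left_ideal_jacobson_radical unfolding left_ideal_iff by auto
  have "x \<otimes> r \<in> M" if x: "x \<in> ?J" and r: "r \<in> carrier R" and M: "maximal_left_ideal M R" for x r M
  proof (rule ccontr)
    assume nM: "x \<otimes> r \<notin> M"
    have xc: "x \<in> carrier R" using x J by blast
    have li: "M \<subseteq> carrier R \<and> \<zero> \<in> M \<and> (\<forall>a\<in>M. \<forall>b\<in>M. a \<oplus> b \<in> M) \<and> (\<forall>a\<in>M. \<ominus> a \<in> M) \<and>
      (\<forall>r\<in>carrier R. \<forall>m\<in>M. r \<otimes> m \<in> M)"
      and neq: "M \<noteq> carrier R"
      using M unfolding maximal_left_ideal_def left_ideal_iff by auto
    have Mc: "m \<in> carrier R" if "m \<in> M" for m using li that by blast
    define N where "N = {m \<oplus> s \<otimes> (x \<otimes> r) | m s. m \<in> M \<and> s \<in> carrier R}"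
    have "left_ideal N R"
      unfolding left_ideal_iff
    proof (intro conjI ballI)
      show "N \<subseteq> carrier R"
        using xc r by (auto simp: N_def Mc)
      show "\<zero> \<in> N"
        using xc r li by (auto simp: N_def intro!: exI[of _ \<zero>])
      show "a \<oplus> b \<in> N" if "a \<in> N" "b \<in> N" for a b
      proof -
        obtain m s n t where ms: "m \<in> M" "s \<in> carrier R" "a = m \<oplus> s \<otimes> (x \<otimes> r)"
          "n \<in> M" "t \<in> carrier R" "b = n \<oplus> t \<otimes> (x \<otimes> r)"
          using \<open>a \<in> N\<close> \<open>b \<in> N\<close> unfolding N_def mem_Collect_eq by metis
        then have "a \<oplus> b = (m \<oplus> n) \<oplus> (s \<oplus> t) \<otimes> (x \<otimes> r)"
          using Mc xc r by (simp add: l_distr a_ac)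
        moreover have "m \<oplus> n \<in> M" "s \<oplus> t \<in> carrier R" using ms li by auto
        ultimately show ?thesis unfolding N_def by blast
      qed
      show "\<ominus> a \<in> N" if "a \<in> N" for a
      proof -
        obtain m s where ms: "m \<in> M" "s \<in> carrier R" "a = m \<oplus> s \<otimes> (x \<otimes> r)"
          using \<open>a \<in> N\<close> unfolding N_def mem_Collect_eq by metis
        then have "\<ominus> a = \<ominus> m \<oplus> (\<ominus> s) \<otimes> (x \<otimes> r)"
          using Mc xc r by (simp add: l_minus minus_add a_ac)
        moreover have "\<ominus> m \<in> M" "\<ominus> s \<in> carrier R" using ms li by auto
        ultimately show ?thesis unfolding N_def by blast
      qed
      show "q \<otimes> a \<in> N" if "q \<in> carrier R" "a \<in> N" for q a
      proof -
        obtain m s where ms: "m \<in> M" "s \<in> carrier R" "a = m \<oplus> s \<otimes> (x \<otimes> r)"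
          using \<open>a \<in> N\<close> unfolding N_def mem_Collect_eq by metis
        then have "q \<otimes> a = q \<otimes> m \<oplus> (q \<otimes> s) \<otimes> (x \<otimes> r)"
          using Mc xc r that by (simp add: r_distr m_assoc)
        moreover have "q \<otimes> m \<in> M" "q \<otimes> s \<in> carrier R" using ms li that by auto
        ultimately show ?thesis unfolding N_def by blast
      qed
    qed
    moreover have "M \<subseteq> N"
    proof
      fix m assume "m \<in> M"
      then have "m = m \<oplus> \<zero> \<otimes> (x \<otimes> r)" using xc r Mc by simp
      then show "m \<in> N" using \<open>m \<in> M\<close> unfolding N_def by blast
    qed
    moreover have "x \<otimes> r \<in> N"
    proof -
      have "x \<otimes> r = \<zero> \<oplus> \<one> \<otimes> (x \<otimes> r)" using xc r by simp
      then show ?thesis using li unfolding N_def by blast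
    qed
    ultimately have "N = carrier R"
      using M nM unfolding maximal_left_ideal_def by blast
    then have "\<one> \<in> N" by simp
    then obtain m s where ms: "m \<in> M" "s \<in> carrier R" "\<one> = m \<oplus> s \<otimes> (x \<otimes> r)"
      unfolding N_def by blast
    have m: "\<one> \<ominus> (s \<otimes> x) \<otimes> r = m"
      using ms xc r Mc by (simp add: a_minus_def m_assoc a_assoc r_neg)
    have "r \<otimes> (s \<otimes> x) \<in> ?J"
      using J ms r x by blast
    then obtain c where c: "c \<in> carrier R" "c \<otimes> (\<one> \<ominus> r \<otimes> (s \<otimes> x)) = \<one>"
      using jacobson_radical_one_minus by blast
    have "(\<one> \<oplus> (s \<otimes> x) \<otimes> c \<otimes> r) \<otimes> m = \<one>"
      using left_inverse_one_minus_swap[OF r _ c(1,2)] ms xc m by simp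
    then have "\<one> \<in> M"
      using li ms(1,2) xc c(1) r by (metis a_closed m_closed one_closed)
    then have "M = carrier R"
      using li by (metis r_one subsetI subset_antisym)
    with neq show False by blast
  qed
  then have "x \<otimes> r \<in> ?J" if "x \<in> ?J" "r \<in> carrier R" for x r
    using that J(1) by (auto simp: jacobson_radical_unital)
  moreover have "subgroup ?J (add_monoid R)"
    using left_ideal_jacobson_radical by (simp add: left_ideal_def additive_subgroup_def)
  ultimately show ?thesis
    using J(2) by (intro idealI ring_axioms) auto
qed

text \<open>
  The left quasi-inverse found in \<open>R\<close> lies in \<open>J(R)\<close> because \<open>y = x + yx\<close>.
\<close>

lemma (in ring) quasi_regular_jacobson_radical: "quasi_regular_ideal (jacobson_radical R) R"
proof (rule ideal.quasi_regular_if_left_quasi_inverses[OF ideal_jacobson_radical])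
  interpret J: ideal "jacobson_radical R" R by (rule ideal_jacobson_radical)
  fix x assume x: "x \<in> jacobson_radical R"
  have xc: "x \<in> carrier R" using x J.a_subset by blast
  obtain y where y: "y \<in> carrier R" "x = y \<ominus> y \<otimes> x"
    using jacobson_radical_left_quasi_inverse[OF oneideal] x by auto
  have "x \<oplus> y \<otimes> x = (y \<ominus> y \<otimes> x) \<oplus> y \<otimes> x"
    using y(2) by simp
  also have "\<dots> = y"
    using y(1) xc by (simp add: a_minus_def a_assoc l_neg)
  finally have "y \<in> jacobson_radical R"
    using x y(1) J.I_l_closed J.a_closed by metis
  then show "\<exists>y\<in>jacobson_radical R. x = y \<ominus> y \<otimes> x"
    using y(2) by blast
qed


section \<open>Conjugate idempotents and clean decompositions\<close>

text \<open>
  The form without inverses is preserved by ring homomorphisms and by inclusions of subrings with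
  no comparison of the inverses in the two rings.
\<close>

lemma (in ring) conjugate_in_iff:
  assumes "e \<in> carrier R" "f \<in> carrier R"
  shows "conjugate_in R e f \<longleftrightarrow> (\<exists>w\<in>Units R. e \<otimes> w = w \<otimes> f)"
proof -
  have "e = w \<otimes> f \<otimes> inv w \<longleftrightarrow> e \<otimes> w = w \<otimes> f" if w: "w \<in> Units R" for w
  proof
    assume "e = w \<otimes> f \<otimes> inv w"
    then show "e \<otimes> w = w \<otimes> f"
      using w assms by (simp add: m_assoc Units_closed)
  next
    assume "e \<otimes> w = w \<otimes> f"
    then show "e = w \<otimes> f \<otimes> inv w"
      using w assms by (metis Units_closed Units_inv_closed Units_r_inv m_assoc r_one)
  qed
  then show ?thesis
    by (auto simp: conjugate_in_def)
qed

context ring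
begin

lemma conjugate_in_trans:
  assumes c: "e \<in> carrier R" "f \<in> carrier R" "g \<in> carrier R"
    and ef: "conjugate_in R e f" and fg: "conjugate_in R f g"
  shows "conjugate_in R e g"
proof -
  obtain v w where v: "v \<in> Units R" "e \<otimes> v = v \<otimes> f" and w: "w \<in> Units R" "f \<otimes> w = w \<otimes> g"
    using ef fg c by (auto simp: conjugate_in_iff)
  have "e \<otimes> (v \<otimes> w) = e \<otimes> v \<otimes> w"
    using c(1) Units_closed[OF v(1)] Units_closed[OF w(1)] by (simp add: m_assoc)
  also have "\<dots> = v \<otimes> (f \<otimes> w)"
    using c v w by (simp add: v(2) m_assoc Units_closed)
  also have "\<dots> = v \<otimes> w \<otimes> g"
    using c v w by (simp add: w(2) m_assoc Units_closed)
  finally show ?thesis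
    using c v w by (auto simp: conjugate_in_iff intro!: bexI[of _ "v \<otimes> w"])
qed

lemma conjugate_idempotent:
  assumes "f \<in> idempotents R" "w \<in> Units R"
  shows "w \<otimes> f \<otimes> inv w \<in> idempotents R"
proof -
  have f: "f \<in> carrier R" "f \<otimes> f = f" using assms by (auto simp: idempotents_def)
  have "w \<otimes> f \<otimes> inv w \<otimes> (w \<otimes> f \<otimes> inv w) = w \<otimes> f \<otimes> (inv w \<otimes> w) \<otimes> f \<otimes> inv w"
    using f(1) assms(2) Units_closed[OF assms(2)] Units_inv_closed[OF assms(2)]
    by (simp add: m_assoc del: Units_l_inv)
  also have "\<dots> = w \<otimes> (f \<otimes> f) \<otimes> inv w"
    using f(1) assms(2) by (simp add: m_assoc Units_closed)
  finally show ?thesis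
    using f assms(2) by (simp add: idempotents_def Units_closed)
qed

text \<open>
  This is the fact that clean rings are exchange rings: for \<open>a = e + u\<close> and \<open>f = u\<^sup>-\<^sup>1(1 - e)u\<close> one
  has \<open>u(f - a) = (1 - e)u - u(e + u) = -(a\<^sup>2 - a)\<close>, so \<open>f - a\<close> is a left multiple of \<open>a\<^sup>2 - a\<close>.
\<close>

lemma idempotents_lift_if_clean:
  assumes clean: "\<And>a. a \<in> carrier R \<Longrightarrow> \<exists>e u. clean_decomposition R a e u"
    and I: "left_ideal I R"
  shows "idempotents_lift R I"
  unfolding idempotents_lift_def
proof (intro ballI impI)
  fix a assume a: "a \<in> carrier R" "a \<otimes> a \<ominus> a \<in> I"
  then obtain e u where eu: "e \<in> idempotents R" "u \<in> Units R" "a = e \<oplus> u"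
    using clean unfolding clean_decomposition_def by blast
  have e: "e \<in> carrier R" "e \<otimes> e = e" using eu(1) by (auto simp: idempotents_def)
  have u: "u \<in> carrier R" using eu(2) by (rule Units_closed)
  define f where "f = inv u \<otimes> (\<one> \<ominus> e) \<otimes> inv (inv u)"
  have "\<one> \<ominus> e \<in> idempotents R"
    using e by (simp add: idempotents_def a_minus_def l_distr r_distr l_minus r_minus minus_add l_neg)
  then have f: "f \<in> idempotents R"
    unfolding f_def using eu(2) by (intro conjugate_idempotent) auto
  have fc: "f \<in> carrier R" using f by (auto simp: idempotents_def)
  have "u \<otimes> f = (\<one> \<ominus> e) \<otimes> u"
    using eu(2) e(1) u by (simp add: f_def m_assoc[symmetric])
  then have "u \<otimes> (f \<ominus> a) = (\<one> \<ominus> e) \<otimes> u \<ominus> u \<otimes> a"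
    using fc u a by (simp add: a_minus_def r_distr r_minus)
  also have "\<dots> = \<ominus> (a \<otimes> a \<ominus> a)"
    using e u by (simp add: eu(3) a_minus_def l_distr r_distr l_minus minus_add a_ac r_neg1 r_neg2 r_neg l_neg)
  finally have uf: "u \<otimes> (f \<ominus> a) = \<ominus> (a \<otimes> a \<ominus> a)" .
  have "f \<ominus> a = inv u \<otimes> (u \<otimes> (f \<ominus> a))"
    using eu(2) u fc a(1) by (simp add: m_assoc[symmetric])
  also have "\<dots> \<in> I"
    unfolding uf using I a(2) eu(2) unfolding left_ideal_iff by simp
  finally show "\<exists>e\<in>idempotents R. e \<ominus> a \<in> I" using f by blast
qed

end

section \<open>Passing to the quotient by a quasi-regular ideal\<close>

text \<open>
  A unit of a quotient ring provides products \<open>ab\<close> and \<open>ba\<close> congruent to \<open>1\<close>, hence invertible but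
  not necessarily equal to \<open>1\<close>.
\<close>

lemma (in monoid) Units_if_products_Units:
  assumes ab: "a \<in> carrier G" "b \<in> carrier G" and "b \<otimes> a \<in> Units G" "a \<otimes> b \<in> Units G"
  shows "a \<in> Units G"
proof -
  let ?l = "inv (b \<otimes> a) \<otimes> b" and ?r = "b \<otimes> inv (a \<otimes> b)"
  have l: "?l \<in> carrier G" "?l \<otimes> a = \<one>" and r: "?r \<in> carrier G" "a \<otimes> ?r = \<one>"
    using assms Units_l_inv[OF assms(3)] Units_r_inv[OF assms(4)] by (simp_all add: m_assoc
        del: Units_l_inv Units_r_inv)
  moreover have "?l = ?r"
    using inv_unique[OF l(2) r(2)] ab l r by simp
  ultimately show ?thesis
    using ab(1) unfolding Units_def by auto
qed

context quasi_regular_ideal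
begin

lemma mem_carrier: "x \<in> I \<Longrightarrow> x \<in> carrier R"
  using a_subset by blast

lemma unit_plus:
  assumes "u \<in> Units R" "x \<in> I"
  shows "u \<oplus> x \<in> Units R"
proof -
  have "u \<oplus> x = u \<otimes> (\<one> \<oplus> inv u \<otimes> x)"
    using assms mem_carrier by (simp add: r_distr m_assoc[symmetric] Units_closed)
  then show ?thesis
    using one_plus_unit[of "inv u \<otimes> x"] assms I_l_closed by simp
qed

lemma unit_if_minus_in:
  assumes "u \<in> Units R" "a \<in> carrier R" "a \<ominus> u \<in> I"
  shows "a \<in> Units R"
proof -
  have "a = u \<oplus> (a \<ominus> u)"
    using assms(2) Units_closed[OF assms(1)] by (simp add: a_minus_def a_ac r_neg)
  then show ?thesis using unit_plus[OF assms(1,3)] by simp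
qed

text \<open>
  The conjugating unit is \<open>p = ef + (1 - e)(1 - f)\<close>: it intertwines \<open>e\<close> and \<open>f\<close> for any two
  idempotents, and it is congruent to \<open>e + (1 - e) = 1\<close> when \<open>e\<close> and \<open>f\<close> are congruent.
\<close>

lemma conjugate_if_congruent:
  assumes e: "e \<in> idempotents R" and f: "f \<in> idempotents R" and ef: "e \<ominus> f \<in> I"
  shows "conjugate_in R e f"
proof -
  have ec: "e \<in> carrier R" "e \<otimes> e = e" and fc: "f \<in> carrier R" "f \<otimes> f = f"
    using e f by (auto simp: idempotents_def)
  define p where "p = e \<otimes> f \<oplus> (\<one> \<ominus> e) \<otimes> (\<one> \<ominus> f)"
  have ee: "e \<otimes> (e \<otimes> y) = e \<otimes> y" if "y \<in> carrier R" for y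
    using that ec by (simp add: m_assoc[symmetric])
  have p: "p = \<one> \<oplus> (e \<otimes> f \<oplus> (e \<otimes> f \<oplus> (\<ominus> e \<oplus> \<ominus> f)))"
    using ec(1) fc(1) by (simp add: p_def a_minus_def l_distr r_distr r_minus l_minus minus_add a_ac)
  have "e \<otimes> p = e \<otimes> f"
    using ec fc ee by (simp add: p r_distr r_minus r_neg r_neg1 r_neg2 a_ac l_neg)
  moreover have "p \<otimes> f = e \<otimes> f"
    using ec fc by (simp add: p l_distr l_minus m_assoc r_neg r_neg1 r_neg2 a_ac l_neg)
  ultimately have epf: "e \<otimes> p = p \<otimes> f" by simp
  \<comment> \<open>This combination of multiples of \<open>e - f\<close> equals \<open>p - 1 = 2ef - e - f\<close>.\<close>
  have "(e \<ominus> f) \<otimes> f \<ominus> e \<otimes> (e \<ominus> f) \<in> I"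
    using ef ec fc I_l_closed I_r_closed by (simp add: a_minus_def)
  also have "(e \<ominus> f) \<otimes> f \<ominus> e \<otimes> (e \<ominus> f) = e \<otimes> f \<oplus> (e \<otimes> f \<oplus> (\<ominus> e \<oplus> \<ominus> f))"
    using ec fc by (simp add: a_minus_def l_distr r_distr r_minus l_minus minus_add a_ac)
  finally have pu: "p \<in> Units R"
    using one_plus_unit p by simp
  show ?thesis
    using pu epf ec(1) fc(1) by (auto simp: conjugate_in_iff)
qed

lemma conjugate_if_conjugate_modulo:
  assumes e: "e \<in> idempotents R" and f: "f \<in> idempotents R" and w: "w \<in> Units R"
    and ef: "e \<otimes> w \<ominus> w \<otimes> f \<in> I"
  shows "conjugate_in R e f"
proof -
  let ?g = "w \<otimes> f \<otimes> inv w"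
  have c: "e \<in> carrier R" "f \<in> carrier R" "w \<in> carrier R" "?g \<in> carrier R"
    using e f w by (auto simp: idempotents_def)
  have "e \<ominus> ?g = (e \<otimes> w \<ominus> w \<otimes> f) \<otimes> inv w"
    using c w by (simp add: a_minus_def l_distr l_minus m_assoc)
  then have "e \<ominus> ?g \<in> I"
    using ef w I_r_closed by simp
  then have "conjugate_in R e ?g"
    using conjugate_if_congruent[OF e conjugate_idempotent[OF f w]] by blast
  moreover have "conjugate_in R ?g f"
    using w unfolding conjugate_in_def by blast
  ultimately show ?thesis
    using conjugate_in_trans c by blast
qed

lemma Units_Quot_iff:
  assumes a: "a \<in> carrier R"
  shows "I +> a \<in> Units (R Quot I) \<longleftrightarrow> a \<in> Units R"
proof
  interpret Q: ring_hom_ring R "R Quot I" "(+>) I" by (rule rcos_ring_hom_ring)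
  assume "a \<in> Units R"
  then have "(I +> inv a) \<otimes>\<^bsub>R Quot I\<^esub> (I +> a) = \<one>\<^bsub>R Quot I\<^esub>"
    "(I +> a) \<otimes>\<^bsub>R Quot I\<^esub> (I +> inv a) = \<one>\<^bsub>R Quot I\<^esub>"
    using a by (simp_all flip: Q.hom_mult Q.hom_one)
  then show "I +> a \<in> Units (R Quot I)"
    using a \<open>a \<in> Units R\<close> unfolding Units_def[of "R Quot I"] by (auto intro!: bexI[of _ "I +> inv a"])
next
  interpret Q: ring_hom_ring R "R Quot I" "(+>) I" by (rule rcos_ring_hom_ring)
  assume "I +> a \<in> Units (R Quot I)"
  then obtain B where B: "B \<in> carrier (R Quot I)"
    "B \<otimes>\<^bsub>R Quot I\<^esub> (I +> a) = \<one>\<^bsub>R Quot I\<^esub>" "(I +> a) \<otimes>\<^bsub>R Quot I\<^esub> B = \<one>\<^bsub>R Quot I\<^esub>"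
    unfolding Units_def by blast
  obtain b where b: "b \<in> carrier R" "B = I +> b"
    using B(1) unfolding FactRing_def A_RCOSETS_def' by auto
  have "I +> (b \<otimes> a) = I +> \<one>" "I +> (a \<otimes> b) = I +> \<one>"
    using B(2,3) a b by (simp_all flip: Q.hom_mult Q.hom_one)
  then have "b \<otimes> a \<in> Units R" "a \<otimes> b \<in> Units R"
    using a b unit_if_minus_in[of \<one>] by (simp_all add: quotient_eq_iff_same_a_r_cos[OF is_ideal])
  then show "a \<in> Units R"
    using Units_if_products_Units[OF a b(1)] by blast
qed

text \<open>
  Under lifting of idempotents, every decomposition of the class of \<open>a\<close> comes from one of \<open>a\<close>
  itself: lift the idempotent to \<open>e\<close> and any representative of the unit, and let the unit absorb the
  remaining error in \<open>I\<close>. As conjugacy also passes back and forth, both halves of conjugate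
  cleanness transfer.
\<close>

theorem conjugate_clean_iff_Quot:
  "conjugate_clean R \<longleftrightarrow> conjugate_clean (R Quot I) \<and> idempotents_lift R I"
proof -
  let ?Q = "R Quot I"
  interpret Q: ring_hom_ring R ?Q "(+>) I" by (rule rcos_ring_hom_ring)
  have carrier_Q: "\<exists>a\<in>carrier R. A = I +> a" if "A \<in> carrier ?Q" for A
    using that unfolding FactRing_def A_RCOSETS_def' by auto
  have eq_iff: "I +> a = I +> b \<longleftrightarrow> a \<ominus> b \<in> I" if "a \<in> carrier R" "b \<in> carrier R" for a b
    using quotient_eq_iff_same_a_r_cos[OF is_ideal that] by simp
  have idem_Q: "I +> e \<in> idempotents ?Q" if "e \<in> idempotents R" for e
    using that by (auto simp: idempotents_def simp flip: Q.hom_mult)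
  have idem_lift: "\<exists>e\<in>idempotents R. A = I +> e"
    if lift: "idempotents_lift R I" and A: "A \<in> idempotents ?Q" for A
  proof -
    obtain a where a: "a \<in> carrier R" "A = I +> a" "A \<otimes>\<^bsub>?Q\<^esub> A = A"
      using A carrier_Q by (auto simp: idempotents_def)
    then have "a \<otimes> a \<ominus> a \<in> I"
      by (simp add: eq_iff flip: Q.hom_mult)
    then obtain e where e: "e \<in> idempotents R" "e \<ominus> a \<in> I"
      using lift a(1) unfolding idempotents_lift_def by blast
    then have "I +> e = I +> a"
      using a(1) by (auto simp: eq_iff idempotents_def)
    then show ?thesis using e(1) a(2) by auto
  qed
  have clean_Q: "clean_decomposition ?Q (I +> a) (I +> e) (I +> u)"
    if "clean_decomposition R a e u" for a e u
    using that idem_Q Units_Quot_iff[of u] Units_closed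
    by (auto simp: clean_decomposition_def idempotents_def simp flip: Q.hom_add)
  have clean_lift: "\<exists>e u. clean_decomposition R a e u \<and> E = I +> e"
    if lift: "idempotents_lift R I" and a: "a \<in> carrier R" and E: "clean_decomposition ?Q (I +> a) E U"
    for a E U
  proof -
    obtain e where e: "e \<in> idempotents R" "E = I +> e"
      using idem_lift[OF lift] E unfolding clean_decomposition_def by blast
    have ec: "e \<in> carrier R" using e(1) by (simp add: idempotents_def)
    obtain u where u: "u \<in> carrier R" "U = I +> u"
      using E carrier_Q Q.S.Units_closed unfolding clean_decomposition_def by blast
    have uR: "u \<in> Units R"
      using E u Units_Quot_iff by (simp add: clean_decomposition_def)
    have "I +> a = I +> (e \<oplus> u)"
      using E e(2) u ec by (simp add: clean_decomposition_def)
    then have "a \<ominus> (e \<oplus> u) \<in> I"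
      using a ec u by (simp add: eq_iff del: Q.hom_add)
    then have "u \<oplus> (a \<ominus> (e \<oplus> u)) \<in> Units R"
      by (rule unit_plus[OF uR])
    moreover have "a = e \<oplus> (u \<oplus> (a \<ominus> (e \<oplus> u)))"
    proof -
      have "e \<oplus> (u \<oplus> (a \<ominus> (e \<oplus> u))) = a \<oplus> ((e \<oplus> u) \<ominus> (e \<oplus> u))"
        using a ec u(1) by (simp add: a_minus_def a_ac)
      also have "\<dots> = a"
        using a ec u(1) by (simp add: a_minus_def r_neg)
      finally show ?thesis ..
    qed
    ultimately show ?thesis
      using e unfolding clean_decomposition_def by blast
  qed
  have conj_Q: "conjugate_in ?Q (I +> e) (I +> f)"
    if ef: "e \<in> carrier R" "f \<in> carrier R" and conj: "conjugate_in R e f" for e f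
  proof -
    obtain w where w: "w \<in> Units R" "e \<otimes> w = w \<otimes> f"
      using conj unfolding conjugate_in_iff[OF ef] by blast
    then have "(I +> e) \<otimes>\<^bsub>?Q\<^esub> (I +> w) = (I +> w) \<otimes>\<^bsub>?Q\<^esub> (I +> f)"
      using ef Units_closed[OF w(1)] by (simp flip: Q.hom_mult)
    moreover have "I +> w \<in> Units ?Q"
      using w(1) Units_Quot_iff Units_closed by blast
    ultimately show ?thesis
      using ef by (auto simp: Q.S.conjugate_in_iff)
  qed
  have conj_lift: "conjugate_in R e f"
    if ef: "e \<in> idempotents R" "f \<in> idempotents R" and conj: "conjugate_in ?Q (I +> e) (I +> f)"
    for e f
  proof -
    have c: "e \<in> carrier R" "f \<in> carrier R" using ef by (auto simp: idempotents_def)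
    obtain W where W: "W \<in> Units ?Q" "(I +> e) \<otimes>\<^bsub>?Q\<^esub> W = W \<otimes>\<^bsub>?Q\<^esub> (I +> f)"
      using conj c by (auto simp: Q.S.conjugate_in_iff)
    obtain w where w: "w \<in> carrier R" "W = I +> w"
      using W(1) carrier_Q Q.S.Units_closed by blast
    have wU: "w \<in> Units R" using W(1) w Units_Quot_iff by simp
    have "e \<otimes> w \<ominus> w \<otimes> f \<in> I"
      using W(2) w c by (simp add: eq_iff flip: Q.hom_mult)
    then show ?thesis using conjugate_if_conjugate_modulo[OF ef wU] by simp
  qed
  show ?thesis
  proof (intro iffI conjI)
    assume R: "conjugate_clean R"
    then have clean: "\<exists>e u. clean_decomposition R a e u" if "a \<in> carrier R" for a
      using that unfolding conjugate_clean_def by blast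
    have "left_ideal I R"
      unfolding left_ideal_def using I_l_closed additive_subgroup_axioms by blast
    then show lift: "idempotents_lift R I"
      using idempotents_lift_if_clean clean by blast
    show "conjugate_clean ?Q"
      unfolding conjugate_clean_def
    proof (intro conjI ballI allI impI; (elim conjE)?)
      fix A assume "A \<in> carrier ?Q"
      then show "\<exists>e u. clean_decomposition ?Q A e u"
        using carrier_Q clean clean_Q by metis
    next
      fix A E U F V
      assume A: "A \<in> carrier ?Q" and EU: "clean_decomposition ?Q A E U"
        and FV: "clean_decomposition ?Q A F V"
      obtain a where a: "a \<in> carrier R" "A = I +> a" using carrier_Q[OF A] by blast
      obtain e u where eu: "clean_decomposition R a e u" "E = I +> e"
        using clean_lift[OF lift a(1)] EU a(2) by blast
      obtain f v where fv: "clean_decomposition R a f v" "F = I +> f"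
        using clean_lift[OF lift a(1)] FV a(2) by blast
      have "conjugate_in R e f"
        using R a(1) eu(1) fv(1) unfolding conjugate_clean_def by blast
      then show "conjugate_in ?Q E F"
        using conj_Q eu fv by (auto simp: clean_decomposition_def idempotents_def)
    qed
  next
    assume asm: "conjugate_clean ?Q \<and> idempotents_lift R I"
    show "conjugate_clean R"
      unfolding conjugate_clean_def
    proof (intro conjI ballI allI impI; (elim conjE)?)
      fix a assume a: "a \<in> carrier R"
      then have "\<exists>E U. clean_decomposition ?Q (I +> a) E U"
        using asm Q.hom_closed unfolding conjugate_clean_def by blast
      then show "\<exists>e u. clean_decomposition R a e u"
        using clean_lift asm a by blast
    next
      fix a e u f v
      assume a: "a \<in> carrier R" and eu: "clean_decomposition R a e u"
        and fv: "clean_decomposition R a f v"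
      have "conjugate_in ?Q (I +> e) (I +> f)"
        using asm Q.hom_closed[OF a] clean_Q[OF eu] clean_Q[OF fv] unfolding conjugate_clean_def by blast
      then show "conjugate_in R e f"
        using conj_lift eu fv by (auto simp: clean_decomposition_def)
    qed
  qed
qed

text \<open>
  The unit condition turns elements of \<open>A\<close> that are congruent modulo \<open>I\<close> to units of \<open>R\<close> into units
  of \<open>A\<close>; this is what makes cleanness of \<open>A\<close> applicable to the components in \<open>A\<close> of a decomposition
  in \<open>R\<close>.
\<close>

theorem conjugate_clean_if_complement:
  assumes A: "subring A R" and ccA: "conjugate_clean (R\<lparr>carrier := A\<rparr>)"
    and sum: "carrier R = A <+> I"
    and units: "Units (R\<lparr>carrier := A\<rparr>) = Units R \<inter> A"
    and idem: "\<And>g. g \<in> idempotents R \<Longrightarrow> \<exists>e\<in>idempotents (R\<lparr>carrier := A\<rparr>). \<exists>x\<in>I. g = e \<oplus> x"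
  shows "conjugate_clean R"
proof -
  let ?A = "R\<lparr>carrier := A\<rparr>"
  interpret A: subring A R by fact
  interpret AR: ring ?A using subring_is_ring[OF A] .
  have Ac: "a \<in> carrier R" if "a \<in> A" for a using that A.subset by blast
  have idem_A: "e \<in> idempotents ?A \<longleftrightarrow> e \<in> A \<and> e \<otimes> e = e" for e
    by (simp add: idempotents_def)
  have split: "\<exists>a\<in>A. \<exists>x\<in>I. r = a \<oplus> x" if "r \<in> carrier R" for r
    using that sum by (auto simp: set_add_def')
  have clean_A: "clean_decomposition ?A a e u \<longleftrightarrow>
      e \<in> A \<and> e \<otimes> e = e \<and> u \<in> Units R \<and> u \<in> A \<and> a = e \<oplus> u" for a e u
    unfolding clean_decomposition_def idem_A units by auto
  show ?thesis
    unfolding conjugate_clean_def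
  proof (intro conjI ballI allI impI; (elim conjE)?)
    fix r assume "r \<in> carrier R"
    then obtain a x where a: "a \<in> A" "x \<in> I" "r = a \<oplus> x" using split by blast
    then obtain e u where "clean_decomposition ?A a e u"
      using ccA by (auto simp: conjugate_clean_def)
    then have eu: "e \<in> A" "e \<otimes> e = e" "u \<in> Units R" "u \<in> A" "a = e \<oplus> u"
      by (auto simp: clean_A)
    then have "r = e \<oplus> (u \<oplus> x)"
      using a Ac mem_carrier by (simp add: a_assoc)
    moreover have "u \<oplus> x \<in> Units R" using unit_plus eu(3) a(2) by blast
    ultimately have "clean_decomposition R r e (u \<oplus> x)"
      using eu Ac by (auto simp: clean_decomposition_def idempotents_def)
    then show "\<exists>e u. clean_decomposition R r e u" by blast
  next
    fix r e u f v
    assume r: "r \<in> carrier R" and eu: "clean_decomposition R r e u"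
      and fv: "clean_decomposition R r f v"
    have e: "e \<in> idempotents R" and f: "f \<in> idempotents R" and uU: "u \<in> Units R" and vU: "v \<in> Units R"
      and req: "e \<oplus> u = f \<oplus> v"
      using eu fv by (auto simp: clean_decomposition_def)
    have c: "e \<in> carrier R" "f \<in> carrier R" "u \<in> carrier R" "v \<in> carrier R"
      using e f uU vU by (auto simp: idempotents_def)
    obtain e0 x where e0: "e0 \<in> A" "e0 \<otimes> e0 = e0" "x \<in> I" "e = e0 \<oplus> x"
      using idem[OF e] by (auto simp: idem_A)
    obtain f0 y where f0: "f0 \<in> A" "f0 \<otimes> f0 = f0" "y \<in> I" "f = f0 \<oplus> y"
      using idem[OF f] by (auto simp: idem_A)
    obtain a i where a: "a \<in> A" "i \<in> I" "u = a \<oplus> i" using split[OF c(3)] by blast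
    note c' = Ac[OF e0(1)] Ac[OF f0(1)] Ac[OF a(1)]
      mem_carrier[OF e0(3)] mem_carrier[OF f0(3)] mem_carrier[OF a(2)]
    have aU: "a \<in> Units R"
    proof (rule unit_if_minus_in[OF uU])
      show "a \<ominus> u \<in> I" using a c' by (simp add: a_minus_def minus_add r_neg1 r_neg2 a_ac)
    qed (rule c')
    \<comment> \<open>An arbitrary component of \<open>v\<close> in \<open>A\<close> need not complete \<open>f0\<close> to \<open>e0 + a\<close>; this one does.\<close>
    define b where "b = a \<oplus> (e0 \<ominus> f0)"
    have bA: "b \<in> A"
      using a(1) e0(1) f0(1) subringE(5,7)[OF A] by (simp add: b_def a_minus_def)
    have "b = v \<oplus> (y \<ominus> x \<ominus> i)"
    proof -
      have "b = (e \<oplus> u) \<oplus> (\<ominus> x \<oplus> (\<ominus> i \<oplus> \<ominus> f0))"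
        using c' by (simp add: b_def a(3) e0(4) a_minus_def minus_add a_ac r_neg1 r_neg2 r_neg l_neg)
      also have "\<dots> = v \<oplus> (y \<ominus> x \<ominus> i) \<oplus> (f0 \<ominus> f0)"
        unfolding req using c' c(4) by (simp add: f0(4) a_minus_def a_ac)
      also have "\<dots> = v \<oplus> (y \<ominus> x \<ominus> i)"
        using c' c(4) by (simp add: a_minus_def r_neg)
      finally show ?thesis .
    qed
    then have bU: "b \<in> Units R"
      using unit_plus[OF vU, of "y \<ominus> x \<ominus> i"] a(2) e0(3) f0(3) by (simp add: a_minus_def)
    have "e0 \<oplus> a = f0 \<oplus> b"
      using c' by (simp add: b_def a_minus_def a_ac r_neg1 r_neg2 r_neg l_neg)
    then have "clean_decomposition ?A (e0 \<oplus> a) e0 a" "clean_decomposition ?A (e0 \<oplus> a) f0 b"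
      using e0 f0 a(1) aU bU bA by (simp_all add: clean_A)
    moreover have "e0 \<oplus> a \<in> carrier ?A"
      using e0(1) a(1) subringE(7)[OF A] by simp
    ultimately have "conjugate_in ?A e0 f0"
      using ccA unfolding conjugate_clean_def by blast
    then obtain w where w: "w \<in> Units R" "e0 \<otimes> w = w \<otimes> f0"
      using e0(1) f0(1) AR.conjugate_in_iff units by auto
    have wc: "w \<in> carrier R" using w(1) by (rule Units_closed)
    have "e \<otimes> w \<ominus> w \<otimes> f = (e0 \<otimes> w \<ominus> w \<otimes> f0) \<oplus> (x \<otimes> w \<ominus> w \<otimes> y)"
      using c' wc by (simp add: e0(4) f0(4) a_minus_def l_distr r_distr minus_add a_ac)
    also have "\<dots> \<in> I"
      using w wc c' e0(3) f0(3) by (simp add: a_minus_def r_neg I_l_closed I_r_closed)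
    finally show "conjugate_in R e f"
      by (rule conjugate_if_conjugate_modulo[OF e f w(1)])
  qed
qed

end

section \<open>Conjugate clean rings modulo radical ideals\<close>

lemma (in ring) jacobson_radical_ideal_zero: "jacobson_radical_ideal {\<zero>} R"
proof -
  have "M = {\<zero>}" if "left_ideal M (R\<lparr>carrier := {\<zero>}\<rparr>)" for M
    using left_ideal_of_idealD(1,2)[OF zeroideal that] by blast
  then have "\<not> maximal_left_ideal M (R\<lparr>carrier := {\<zero>}\<rparr>)" for M
    by (auto simp: maximal_left_ideal_def)
  then show ?thesis
    by (auto simp: jacobson_radical_ideal_def zeroideal jacobson_radical_def)
qed

theorem theorem2p11:
  fixes R :: "('a, 'b) ring_scheme" (structure)
  assumes "ring R"
  shows
    "(conjugate_clean R \<longleftrightarrow>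
        conjugate_clean (R Quot jacobson_radical R) \<and> idempotents_lift R (jacobson_radical R)) \<and>
     (conjugate_clean R \<longleftrightarrow>
        (\<exists>A I. subring A R \<and> conjugate_clean (R\<lparr>carrier := A\<rparr>) \<and> jacobson_radical_ideal I R \<and>
           carrier R = A <+> I \<and>
           Units (R\<lparr>carrier := A\<rparr>) = Units R \<inter> A \<and>
           (\<forall>g\<in>idempotents R. \<exists>e\<in>idempotents (R\<lparr>carrier := A\<rparr>). \<exists>x\<in>I. g = e \<oplus> x)))"
proof (intro conjI iffI)
  interpret ring R by fact
  note quot = quasi_regular_ideal.conjugate_clean_iff_Quot[OF quasi_regular_jacobson_radical]
  show "conjugate_clean (R Quot jacobson_radical R)" if "conjugate_clean R"
    using that quot by blast
  show "idempotents_lift R (jacobson_radical R)" if "conjugate_clean R"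
    using that quot by blast
  show "conjugate_clean R"
    if "conjugate_clean (R Quot jacobson_radical R) \<and> idempotents_lift R (jacobson_radical R)"
    using that quot by blast
  show "\<exists>A I. subring A R \<and> conjugate_clean (R\<lparr>carrier := A\<rparr>) \<and> jacobson_radical_ideal I R \<and>
      carrier R = A <+> I \<and>
      Units (R\<lparr>carrier := A\<rparr>) = Units R \<inter> A \<and>
      (\<forall>g\<in>idempotents R. \<exists>e\<in>idempotents (R\<lparr>carrier := A\<rparr>). \<exists>x\<in>I. g = e \<oplus> x)"
    if "conjugate_clean R"
  proof (intro exI conjI)
    show "subring (carrier R) R" by (rule carrier_is_subring)
    show "jacobson_radical_ideal {\<zero>} R" by (rule jacobson_radical_ideal_zero)
    show "carrier R = carrier R <+> {\<zero>}" by (force simp: set_add_def')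
  qed (use that in \<open>auto simp: idempotents_def Units_def\<close>)
  show "conjugate_clean R"
    if "\<exists>A I. subring A R \<and> conjugate_clean (R\<lparr>carrier := A\<rparr>) \<and> jacobson_radical_ideal I R \<and>
      carrier R = A <+> I \<and>
      Units (R\<lparr>carrier := A\<rparr>) = Units R \<inter> A \<and>
      (\<forall>g\<in>idempotents R. \<exists>e\<in>idempotents (R\<lparr>carrier := A\<rparr>). \<exists>x\<in>I. g = e \<oplus> x)"
    using that quasi_regular_ideal.conjugate_clean_if_complement[OF jacobson_radical_ideal_quasi_regular]
    by blast
qed

end
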